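(* Let $y=(y_w)_{w\in\langle \underline X\rangle}$ be a tracial sequence whose tracial moment matrix $M(y)$ is positive semidefinite and of finite rank $t$. Then $y$ is a tracial moment sequence; more precisely, there exist finitely many tuples $\underline A^{(i)}=(A^{(i)}_1,\dots,A^{(i)}_n)$ of real symmetric matrices $A^{(i)}_j$ of size at most $t$ (all matrices within one tuple having the same size) and $\lambda_i\in\mathbb R_{\ge 0}$ with $\sum_i\lambda_i=1$ such that $$y_w=\sum_i\lambda_i\operatorname{Tr}\big(w(\underline A^{(i)})\big)\qquad\text{for all } w\in\langle \underline X\rangle .$$
   Context: Let $\langle\underline X\rangle$ be the free monoid of words in the non-commuting letters $\underline X=(X_1,\dots,X_n)$, with empty word $\emptyset=1$. For a word $w$, $w^*$ is the reversed word. Two words are cyclically equivalent, $w\overset{\mathrm{cyc}}{\sim}u$, if $u$ is a cyclic permutation of $w$ (i.e. $w=u_1u_2$, $u=u_2u_1$ for some words $u_1,u_2$). $w(\underline A)$ denotes the evaluation of $w$ at a tuple of square matrices of equal size. $\operatorname{Tr}(A)=\frac1s\operatorname{tr}(A)$ for $A\in\mathbb R^{s\times s}$ is the normalized trace. A tracial sequence is a family of real numbers $(y_w)_{w\in\langle\underline X\rangle}$ with $y_w=y_u$ whenever $w\overset{\mathrm{cyc}}{\sim}u$, $y_w=y_{w^*}$ for all $w$, and $y_\emptyset=1$. Its tracial moment matrix is the infinite matrix $M(y)=(y_{u^*v})_{u,v\in\langle\underline X\rangle}$; it is positive semidefinite if all its finite principal submatrices are, and its rank is the dimension of the span of its columns.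 $y$ is a tracial moment sequence if there are $N,s\in\mathbb N$, $\lambda_i\ge0$ with $\sum_{i=1}^N\lambda_i=1$ and tuples $\underline A^{(i)}$ of $n$ real symmetric $s\times s$ matrices with $y_w=\sum_{i=1}^N\lambda_i\operatorname{Tr}(w(\underline A^{(i)}))$ for all words $w$. *)

theory Defs
  imports Complex_Main "HOL-Library.Function_Algebras" "Jordan_Normal_Form.Matrix"
begin

instantiation "fun" :: (type, real_vector) real_vector
begin

definition scaleR_fun :: "real \<Rightarrow> ('a \<Rightarrow> 'b) \<Rightarrow> 'a \<Rightarrow> 'b"
  where "scaleR_fun c f = (\<lambda>x. c *\<^sub>R f x)"

instance
  by standard (simp_all add: scaleR_fun_def fun_eq_iff scaleR_add_right scaleR_add_left)

end

text \<open>
  The words in the letters X_1, ..., X_n are the lists over a finite type \<open>'n\<close> with n elements: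
  \<open>[]\<close> is the empty word, \<open>@\<close> the multiplication and \<open>rev\<close> the involution.
\<close>

definition cyc_equiv :: "'n list \<Rightarrow> 'n list \<Rightarrow> bool"
  where "cyc_equiv w u \<longleftrightarrow> (\<exists>u1 u2. w = u1 @ u2 \<and> u = u2 @ u1)"

definition tracial_sequence :: "('n list \<Rightarrow> real) \<Rightarrow> bool"
  where "tracial_sequence y \<longleftrightarrow>
    (\<forall>w u. cyc_equiv w u \<longrightarrow> y w = y u) \<and> (\<forall>w. y w = y (rev w)) \<and> y [] = 1"

text \<open>
  An infinite matrix with rows and columns indexed by \<open>'i\<close> is a function \<open>'i \<Rightarrow> 'i \<Rightarrow> real\<close>
  (row index first).
\<close>

definition tracial_moment_matrix :: "('n list \<Rightarrow> real) \<Rightarrow> 'n list \<Rightarrow> 'n list \<Rightarrow> real"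
  where "tracial_moment_matrix y u v = y (rev u @ v)"

definition psd_submatrix :: "('i \<Rightarrow> 'i \<Rightarrow> real) \<Rightarrow> 'i set \<Rightarrow> bool"
  where "psd_submatrix M F \<longleftrightarrow>
    (\<forall>u\<in>F. \<forall>v\<in>F. M u v = M v u) \<and>
    (\<forall>c :: 'i \<Rightarrow> real. 0 \<le> (\<Sum>u\<in>F. \<Sum>v\<in>F. c u * M u v * c v))"

definition psd_infmat :: "('i \<Rightarrow> 'i \<Rightarrow> real) \<Rightarrow> bool"
  where "psd_infmat M \<longleftrightarrow> (\<forall>F. finite F \<longrightarrow> psd_submatrix M F)"

definition infmat_columns :: "('i \<Rightarrow> 'i \<Rightarrow> real) \<Rightarrow> ('i \<Rightarrow> real) set"
  where "infmat_columns M = range (\<lambda>v. \<lambda>u. M u v)"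

text \<open>
  \<open>dim\<close> is \<open>0\<close> on infinite-dimensional spaces, so \<open>infmat_rank\<close> is meaningful only together with
  \<open>finite_rank_infmat\<close>.
\<close>

definition finite_rank_infmat :: "('i \<Rightarrow> 'i \<Rightarrow> real) \<Rightarrow> bool"
  where "finite_rank_infmat M \<longleftrightarrow> (\<exists>B. finite B \<and> span (infmat_columns M) = span B)"

definition infmat_rank :: "('i \<Rightarrow> 'i \<Rightarrow> real) \<Rightarrow> nat"
  where "infmat_rank M = dim (span (infmat_columns M))"

definition sym_mats :: "nat \<Rightarrow> real mat set"
  where "sym_mats s = {A \<in> carrier_mat s s. transpose_mat A = A}"

text \<open>The size \<open>s\<close> is an argument because it determines the value at the empty word.\<close>

primrec word_eval :: "nat \<Rightarrow> ('n \<Rightarrow> real mat) \<Rightarrow> 'n list \<Rightarrow> real mat"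
  where
    "word_eval s A [] = 1\<^sub>m s"
  | "word_eval s A (x # w) = A x * word_eval s A w"

definition normalized_trace :: "real mat \<Rightarrow> real"
  where "normalized_trace A = (\<Sum>i<dim_row A. A $$ (i, i)) / real (dim_row A)"

definition tracial_moment_sequence :: "('n list \<Rightarrow> real) \<Rightarrow> bool"
  where "tracial_moment_sequence y \<longleftrightarrow>
    (\<exists>(N::nat) (s::nat) (l :: nat \<Rightarrow> real) (A :: nat \<Rightarrow> 'n \<Rightarrow> real mat).
      0 < s \<and>
      (\<forall>i<N. 0 \<le> l i) \<and> (\<Sum>i<N. l i) = 1 \<and>
      (\<forall>i<N. \<forall>j. A i j \<in> sym_mats s) \<and>
      (\<forall>w. y w = (\<Sum>i<N. l i * normalized_trace (word_eval s (A i) w))))"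

end

theory Submission
  imports Defs "Jordan_Normal_Form.Char_Poly" "HOL-Computational_Algebra.Fundamental_Theorem_Algebra"
begin

text \<open>
  The GNS construction turns the words into vectors spanning a Euclidean space \<open>E\<close> of dimension \<open>t\<close>,
  on which the letters act by symmetric left and right multiplications. As \<open>y\<close> is tracial, \<open>E\<close> is
  itself an algebra with involution. The Wedderburn decomposition can be avoided: represent the trace
  form \<open>(a, b) \<mapsto> tr (L\<^sub>a\<^sup>T L\<^sub>b)\<close> of the left regular representation \<open>L\<close> by a symmetric operator \<open>S\<close>
  on \<open>E\<close>. It commutes with all left and right multiplications, so its eigenspaces \<open>E\<^sub>\<mu>\<close> are two-sided
  ideals, orthogonal to each other, with units \<open>e\<^sub>\<mu>\<close> that add up to 1. Since \<open>L\<close> of \<open>e\<^sub>\<mu>\<close> is the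
  orthogonal projection onto \<open>E\<^sub>\<mu>\<close>, the trace of \<open>L\<^sub>a\<close> on \<open>E\<^sub>\<mu>\<close> is
  \<open>\<langle>S e\<^sub>\<mu>, a\<rangle> = \<mu> \<langle>e\<^sub>\<mu>, a\<rangle>\<close>, which for \<open>a = 1\<close> gives \<open>dim E\<^sub>\<mu> = \<mu> \<langle>e\<^sub>\<mu>, 1\<rangle>\<close>. Hence
  \<open>\<langle>1, a\<rangle>\<close>, the sum of the \<open>\<langle>e\<^sub>\<mu>, a\<rangle>\<close>, is the convex combination with the weights \<open>\<langle>e\<^sub>\<mu>, 1\<rangle>\<close> of the
  normalized traces of \<open>L\<^sub>a\<close> on the \<open>E\<^sub>\<mu>\<close>.
\<close>

section \<open>Diagonalization of real symmetric matrices\<close>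

text \<open>The characteristic polynomial has a complex root, with eigenvector \<open>z\<close>.
  Symmetry forces the root to be real, and then a nonzero one among the real and imaginary parts of
  \<open>z\<close> is a real eigenvector.\<close>

lemma real_symmetric_mat_eigenvector:
  fixes S :: "real mat"
  assumes S: "S \<in> carrier_mat n n" and sym: "transpose_mat S = S" and n: "0 < n"
  obtains a v where "v \<in> carrier_vec n" "v \<noteq> 0\<^sub>v n" "S *\<^sub>v v = a \<cdot>\<^sub>v v"
proof -
  define C :: "complex mat" where "C = map_mat complex_of_real S"
  have C: "C \<in> carrier_mat n n"
    using S by (simp add: C_def)
  have "\<not> constant (poly (char_poly C))"
    using degree_monic_char_poly[OF C] n by (simp add: constant_degree)
  then obtain c where "poly (char_poly C) c = 0"
    using fundamental_theorem_of_algebra by blast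
  then obtain z where z: "z \<in> carrier_vec n" "z \<noteq> 0\<^sub>v n" "C *\<^sub>v z = c \<cdot>\<^sub>v z"
    using C by (auto simp: eigenvalue_root_char_poly[OF C, symmetric] eigenvalue_def eigenvector_def)
  have row: "(\<Sum>j<n. of_real (S $$ (i, j)) * z $ j) = c * z $ i" if "i < n" for i
  proof -
    have "(C *\<^sub>v z) $ i = (\<Sum>j<n. of_real (S $$ (i, j)) * z $ j)"
      using S z(1) that by (simp add: C_def scalar_prod_def lessThan_atLeast0)
    then show ?thesis using z that by simp
  qed
  have re: "(\<Sum>j<n. S $$ (i, j) * Re (z $ j)) = Re c * Re (z $ i) - Im c * Im (z $ i)" if "i < n" for i
    using arg_cong[OF row[OF that], of Re] by simp
  have im: "(\<Sum>j<n. S $$ (i, j) * Im (z $ j)) = Re c * Im (z $ i) + Im c * Re (z $ i)" if "i < n" for i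
    using arg_cong[OF row[OF that], of Im] by simp
  have S_sym: "S $$ (i, j) = S $$ (j, i)" if "i < n" "j < n" for i j
    using that S arg_cong[OF sym, of "\<lambda>A. A $$ (i, j)"] by simp
  \<comment> \<open>Symmetry moves \<open>S\<close> from the real to the imaginary part of
    \<open>z\<close>; by \<open>re\<close> and \<open>im\<close> the two sides differ by
    \<open>Im c\<close> times the squared norm of \<open>z\<close>.\<close>
  have "(\<Sum>i<n. (\<Sum>j<n. S $$ (i, j) * Re (z $ j)) * Im (z $ i)) =
        (\<Sum>j<n. \<Sum>i<n. S $$ (i, j) * Re (z $ j) * Im (z $ i))"
    by (subst sum.swap) (simp add: sum_distrib_right)
  also have "\<dots> = (\<Sum>j<n. (\<Sum>i<n. S $$ (j, i) * Im (z $ i)) * Re (z $ j))"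
    by (simp add: sum_distrib_left sum_distrib_right S_sym ac_simps)
  finally have "(\<Sum>i<n. (Re c * Re (z $ i) - Im c * Im (z $ i)) * Im (z $ i)) =
      (\<Sum>i<n. (Re c * Im (z $ i) + Im c * Re (z $ i)) * Re (z $ i))"
    by (simp add: re im)
  then have "(\<Sum>i<n. Im c * ((Re (z $ i))\<^sup>2 + (Im (z $ i))\<^sup>2)) = 0"
    by (simp add: algebra_simps power2_eq_square sum.distrib sum_subtractf)
  moreover have "(\<Sum>i<n. (Re (z $ i))\<^sup>2 + (Im (z $ i))\<^sup>2) \<noteq> 0"
  proof
    assume *: "(\<Sum>i<n. (Re (z $ i))\<^sup>2 + (Im (z $ i))\<^sup>2) = 0"
    have "z $ i = 0" if "i < n" for i
      using * that by (subst (asm) sum_nonneg_eq_0_iff) (auto simp: complex_eq_iff sum_power2_eq_zero_iff)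
    then show False using z(1,2) by auto
  qed
  ultimately have im0: "Im c = 0"
    by (simp add: sum_distrib_left[symmetric])
  have real_part: "S *\<^sub>v map_vec f z = Re c \<cdot>\<^sub>v map_vec f z"
    if "\<And>i. i < n \<Longrightarrow> (\<Sum>j<n. S $$ (i, j) * f (z $ j)) = Re c * f (z $ i)" for f :: "complex \<Rightarrow> real"
    using S z(1) that by (intro eq_vecI) (simp_all add: scalar_prod_def lessThan_atLeast0)
  have "map_vec Re z \<noteq> 0\<^sub>v n \<or> map_vec Im z \<noteq> 0\<^sub>v n"
  proof (rule ccontr)
    assume "\<not> ?thesis"
    then have "Re (z $ i) = 0 \<and> Im (z $ i) = 0" if "i < n" for i
      using z(1) that by (metis carrier_vecD index_map_vec(1) index_zero_vec(1))
    then have "z = 0\<^sub>v n" using z(1) by (intro eq_vecI) (auto simp: complex_eq_iff)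
    with z(2) show False by simp
  qed
  then show thesis
    using that[of "map_vec Re z" "Re c"] that[of "map_vec Im z" "Re c"] real_part[of Re] real_part[of Im]
      re im im0 z(1) by auto
qed

text \<open>The Householder reflection exchanging \<open>x\<close> and the first unit vector; for \<open>x\<close> equal to that
  vector the coefficient is \<open>2 / 0 = 0\<close> and the matrix is the identity, as it should.\<close>

lemma householder:
  fixes x :: "real vec"
  assumes x: "x \<in> carrier_vec n" and unit: "x \<bullet> x = 1" and n: "0 < n"
  obtains H where "H \<in> carrier_mat n n" "transpose_mat H = H" "H * H = 1\<^sub>m n" "col H 0 = x"
proof -
  define v where "v i = x $ i - of_bool (i = 0)" for i
  define s where "s = (\<Sum>k<n. v k * v k)"
  define c where "c = 2 / s"
  define H where "H = mat n n (\<lambda>(i, j). of_bool (i = j) - c * v i * v j)"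
  have H: "H \<in> carrier_mat n n" by (simp add: H_def)
  have H_sym: "transpose_mat H = H" by (intro eq_matI) (auto simp: H_def)
  have xx: "(\<Sum>k<n. x $ k * x $ k) = 1"
    using unit x by (simp add: scalar_prod_def lessThan_atLeast0)
  \<comment> \<open>The squared distance of two unit vectors. It gives \<open>v 0 = - s / 2\<close>,
    hence \<open>c * v 0 = -1\<close> for nonzero \<open>s\<close>, which turns the first column of
    \<open>H\<close> into \<open>x\<close>.\<close>
  have s: "s = 2 - 2 * x $ 0"
  proof -
    have "v k * v k = x $ k * x $ k - 2 * (of_bool (k = 0) * x $ k) + of_bool (k = 0)" for k
      by (cases "k = 0") (simp_all add: v_def algebra_simps)
    then have "s = (\<Sum>k<n. x $ k * x $ k) - 2 * (\<Sum>k<n. of_bool (k = 0) * x $ k) + (\<Sum>k<n. of_bool (k = 0))"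
      unfolding s_def by (simp only: sum.distrib sum_subtractf sum_distrib_left)
    also have "(\<Sum>k<n. of_bool (k = 0) * x $ k) = x $ 0"
      using n by (simp add: sum.remove[of _ 0])
    also have "(\<Sum>k<n. of_bool (k = 0)) = (1 :: real)"
      using n by (simp add: sum.remove[of _ 0])
    finally show ?thesis by (simp add: xx)
  qed
  have s0: "v i = 0" if "s = 0" "i < n" for i
    using that by (auto simp: s_def sum_nonneg_eq_0_iff)
  have HH: "H * H = 1\<^sub>m n"
  proof (rule eq_matI)
    fix i j assume "i < dim_row (1\<^sub>m n :: real mat)" "j < dim_col (1\<^sub>m n :: real mat)"
    then have ij: "i < n" "j < n" by auto
    have "(H * H) $$ (i, j) =
        (\<Sum>k<n. (of_bool (i = k) - c * v i * v k) * (of_bool (k = j) - c * v k * v j))"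
      using ij by (simp add: H_def scalar_prod_def lessThan_atLeast0)
    also have "\<dots> = (\<Sum>k<n. of_bool (i = k) * of_bool (k = j)) - (\<Sum>k<n. of_bool (i = k) * (c * v k * v j))
        - (\<Sum>k<n. of_bool (k = j) * (c * v i * v k)) + c\<^sup>2 * v i * v j * s"
      unfolding s_def sum_distrib_left sum_subtractf[symmetric] sum.distrib[symmetric]
      by (intro sum.cong) (simp_all add: algebra_simps power2_eq_square)
    also have "(\<Sum>k<n. of_bool (i = k) * of_bool (k = j)) = (of_bool (i = j) :: real)"
      using ij by (simp add: sum.remove[of _ i])
    also have "(\<Sum>k<n. of_bool (i = k) * (c * v k * v j)) = c * v i * v j"
      using ij by (simp add: sum.remove[of _ i])
    also have "(\<Sum>k<n. of_bool (k = j) * (c * v i * v k)) = c * v i * v j"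
      using ij by (simp add: sum.remove[of _ j])
    also have "of_bool (i = j) - c * v i * v j - c * v i * v j + c\<^sup>2 * v i * v j * s = of_bool (i = j)"
      by (cases "s = 0") (simp_all add: c_def field_simps power2_eq_square)
    finally show "(H * H) $$ (i, j) = 1\<^sub>m n $$ (i, j)" using ij by simp
  qed (auto simp: H_def)
  have "col H 0 = x"
  proof (rule eq_vecI)
    fix i assume "i < dim_vec x"
    then have i: "i < n" using x by simp
    have "of_bool (i = 0) - c * v i * v 0 = of_bool (i = 0) + v i"
    proof (cases "s = 0")
      case True
      then show ?thesis using s0[of i] i by (simp add: c_def)
    next
      case False
      have "v 0 = - s / 2" using s by (simp add: v_def)
      with False show ?thesis by (simp add: c_def)
    qed
    then show "col H 0 $ i = x $ i" using i n by (simp add: H_def v_def)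
  qed (use x in \<open>auto simp: H_def\<close>)
  with H H_sym HH show thesis by (rule that)
qed

text \<open>Induction by deflation: a reflection \<open>H\<close> taking the first unit vector to a
  unit eigenvector clears the first row and column of \<open>H * S * H\<close> off the diagonal, and
  the remaining block is again symmetric.\<close>

lemma real_symmetric_mat_diagonalization:
  fixes S :: "real mat"
  assumes "S \<in> carrier_mat n n" "transpose_mat S = S"
  shows "\<exists>Q\<in>carrier_mat n n. transpose_mat Q * Q = 1\<^sub>m n \<and> Q * transpose_mat Q = 1\<^sub>m n \<and>
    diagonal_mat (transpose_mat Q * S * Q)"
  using assms
proof (induction n arbitrary: S)
  case 0
  then show ?case by (intro bexI[of _ "1\<^sub>m 0"]) (auto simp: diagonal_mat_def)
next
  case (Suc n)
  note S = Suc.prems(1) and sym = Suc.prems(2)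
  obtain a v where v: "v \<in> carrier_vec (Suc n)" "v \<noteq> 0\<^sub>v (Suc n)" "S *\<^sub>v v = a \<cdot>\<^sub>v v"
    by (rule real_symmetric_mat_eigenvector[OF S sym zero_less_Suc])
  define x where "x = (1 / sqrt (v \<bullet> v)) \<cdot>\<^sub>v v"
  have x: "x \<in> carrier_vec (Suc n)" using v by (simp add: x_def)
  have pos: "0 < v \<bullet> v"
  proof -
    have "v \<bullet> v = (\<Sum>i<Suc n. (v $ i)\<^sup>2)"
      using v(1) by (simp add: scalar_prod_def lessThan_atLeast0 power2_eq_square)
    moreover have "\<exists>i<Suc n. v $ i \<noteq> 0" using v(1,2) by auto
    ultimately show ?thesis by (auto intro!: sum_pos2 simp del: sum.lessThan_Suc)
  qed
  have unit: "x \<bullet> x = 1" using pos v(1) by (simp add: x_def)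
  have Sx: "S *\<^sub>v x = a \<cdot>\<^sub>v x"
    using v S by (simp add: x_def mult_mat_vec[of _ "Suc n" "Suc n"] smult_smult_assoc ac_simps)
  obtain H where H: "H \<in> carrier_mat (Suc n) (Suc n)" "transpose_mat H = H" "H * H = 1\<^sub>m (Suc n)" "col H 0 = x"
    using householder[OF x unit] by auto
  note carr = S H(1)
  define M where "M = H * S * H"
  have M: "M \<in> carrier_mat (Suc n) (Suc n)" using carr by (simp add: M_def)
  have M_sym: "transpose_mat M = M"
    using carr by (simp add: M_def transpose_mult[of _ "Suc n" "Suc n" _ "Suc n"] H sym
        assoc_mult_mat[of _ "Suc n" "Suc n" _ "Suc n" _ "Suc n"])
  have "col M 0 = (H * S) *\<^sub>v x"
    unfolding M_def H(4)[symmetric] using carr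
    by (intro col_mult2[of _ "Suc n" "Suc n" _ "Suc n"]) auto
  also have "\<dots> = a \<cdot>\<^sub>v (H *\<^sub>v col H 0)"
    using carr x Sx by (simp add: assoc_mult_mat_vec[of _ "Suc n" "Suc n"] mult_mat_vec[of _ "Suc n" "Suc n"] H(4))
  also have "H *\<^sub>v col H 0 = col (1\<^sub>m (Suc n)) 0"
    using H(1) by (simp add: H(3)[symmetric] col_mult2[of _ "Suc n" "Suc n"])
  finally have col0: "col M 0 = a \<cdot>\<^sub>v unit_vec (Suc n) 0" by simp
  have M0: "M $$ (i, 0) = (if i = 0 then a else 0)" "M $$ (0, i) = (if i = 0 then a else 0)" if "i < Suc n" for i
  proof -
    show 1: "M $$ (i, 0) = (if i = 0 then a else 0)"
      using arg_cong[OF col0, of "\<lambda>u. u $ i"] M that by (auto simp: unit_vec_def)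
    show "M $$ (0, i) = (if i = 0 then a else 0)"
      using arg_cong[OF M_sym, of "\<lambda>A. A $$ (i, 0)"] M that 1 by simp
  qed
  define S' where "S' = mat n n (\<lambda>(i, j). M $$ (Suc i, Suc j))"
  have S': "S' \<in> carrier_mat n n" by (simp add: S'_def)
  have M_block: "M = four_block_mat (mat 1 1 (\<lambda>_. a)) (0\<^sub>m 1 n) (0\<^sub>m n 1) S'"
    using M M0 by (intro eq_matI) (auto simp: S'_def less_Suc_eq_0_disj)
  have "transpose_mat S' = S'"
  proof (rule eq_matI)
    fix i j assume "i < dim_row S'" "j < dim_col S'"
    then show "transpose_mat S' $$ (i, j) = S' $$ (i, j)"
      using arg_cong[OF M_sym, of "\<lambda>A. A $$ (Suc i, Suc j)"] M by (simp add: S'_def)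
  qed (auto simp: S'_def)
  from Suc.IH[OF S' this] obtain R where R: "R \<in> carrier_mat n n" "transpose_mat R * R = 1\<^sub>m n"
      "R * transpose_mat R = 1\<^sub>m n" "diagonal_mat (transpose_mat R * S' * R)" by blast
  define U where "U = four_block_mat (1\<^sub>m 1) (0\<^sub>m 1 n) (0\<^sub>m n 1) R"
  have U: "U \<in> carrier_mat (Suc n) (Suc n)" using R by (auto simp: U_def)
  have U_t: "transpose_mat U = four_block_mat (1\<^sub>m 1) (0\<^sub>m 1 n) (0\<^sub>m n 1) (transpose_mat R)"
    using R by (simp add: U_def transpose_four_block_mat[of _ 1 1 _ n _ n])
  have UU: "transpose_mat U * U = 1\<^sub>m (Suc n)" "U * transpose_mat U = 1\<^sub>m (Suc n)"
    using R by (simp_all add: U_t) (simp_all add: U_def mult_four_block_mat[of _ 1 1 _ n _ n _ _ 1 _ n])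
  have UMU: "transpose_mat U * M * U = four_block_mat (mat 1 1 (\<lambda>_. a)) (0\<^sub>m 1 n) (0\<^sub>m n 1) (transpose_mat R * S' * R)"
    using R S' by (simp add: U_t) (simp add: U_def M_block mult_four_block_mat[of _ 1 1 _ n _ n _ _ 1 _ n])
  define Q where "Q = H * U"
  have Q: "Q \<in> carrier_mat (Suc n) (Suc n)" using H U by (simp add: Q_def)
  have Q_t: "transpose_mat Q = transpose_mat U * H"
    using H U by (simp add: Q_def transpose_mult[of _ "Suc n" "Suc n" _ "Suc n"])
  note assoc = assoc_mult_mat[of _ "Suc n" "Suc n" _ "Suc n" _ "Suc n"]
  have "transpose_mat Q * Q = transpose_mat U * (H * H) * U"
    unfolding Q_t unfolding Q_def using H(1) U by (simp add: assoc)
  then have 1: "transpose_mat Q * Q = 1\<^sub>m (Suc n)" using U by (simp add: H(3) UU)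
  have "Q * transpose_mat Q = H * (U * transpose_mat U) * H"
    unfolding Q_t unfolding Q_def using H(1) U by (simp add: assoc)
  then have 2: "Q * transpose_mat Q = 1\<^sub>m (Suc n)" using H(1) by (simp add: H(3) UU)
  have "transpose_mat Q * S * Q = transpose_mat U * M * U"
    unfolding Q_t unfolding Q_def M_def using H(1) U S by (simp add: assoc)
  moreover have "diagonal_mat \<dots>"
    unfolding UMU using R S' by (auto simp: diagonal_mat_def)
  ultimately show ?case using Q 1 2 by auto
qed

lemma real_symmetric_diagonalization:
  fixes S :: "nat \<Rightarrow> nat \<Rightarrow> real"
  assumes sym: "\<And>a b. a < n \<Longrightarrow> b < n \<Longrightarrow> S a b = S b a"
  obtains Q d where
    "\<And>k l. k < n \<Longrightarrow> l < n \<Longrightarrow> (\<Sum>a<n. Q a k * Q a l) = of_bool (k = l)"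
    "\<And>a b. a < n \<Longrightarrow> b < n \<Longrightarrow> (\<Sum>k<n. Q a k * Q b k) = of_bool (a = b)"
    "\<And>k l. k < n \<Longrightarrow> l < n \<Longrightarrow> (\<Sum>a<n. \<Sum>b<n. Q a k * S a b * Q b l) = of_bool (k = l) * d k"
proof -
  define M where "M = mat n n (\<lambda>(a, b). S a b)"
  have M: "M \<in> carrier_mat n n" by (simp add: M_def)
  have "transpose_mat M = M" using sym by (intro eq_matI) (auto simp: M_def)
  from real_symmetric_mat_diagonalization[OF M this] obtain Q where Q: "Q \<in> carrier_mat n n"
    "transpose_mat Q * Q = 1\<^sub>m n" "Q * transpose_mat Q = 1\<^sub>m n" "diagonal_mat (transpose_mat Q * M * Q)"
    by blast
  define d where "d k = (transpose_mat Q * M * Q) $$ (k, k)" for k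
  show thesis
  proof (rule that[of "\<lambda>a k. Q $$ (a, k)" d])
    fix k l assume kl: "k < n" "l < n"
    show "(\<Sum>a<n. Q $$ (a, k) * Q $$ (a, l)) = of_bool (k = l)"
      using arg_cong[OF Q(2), of "\<lambda>A. A $$ (k, l)"] Q(1) kl by (simp add: scalar_prod_def lessThan_atLeast0)
    show "(\<Sum>a<n. Q $$ (k, a) * Q $$ (l, a)) = of_bool (k = l)"
      using arg_cong[OF Q(3), of "\<lambda>A. A $$ (k, l)"] Q(1) kl by (simp add: scalar_prod_def lessThan_atLeast0)
    have "(transpose_mat Q * M * Q) $$ (k, l) = of_bool (k = l) * d k"
      using Q(1,4) kl M by (auto simp: d_def diagonal_mat_def)
    moreover have "(transpose_mat Q * M * Q) $$ (k, l) = (\<Sum>b<n. (\<Sum>a<n. Q $$ (a, k) * S a b) * Q $$ (b, l))"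
      using Q(1) kl by (simp add: scalar_prod_def lessThan_atLeast0 M_def)
    ultimately show "(\<Sum>a<n. \<Sum>b<n. Q $$ (a, k) * S a b * Q $$ (b, l)) = of_bool (k = l) * d k"
      by (subst sum.swap) (simp add: sum_distrib_right)
  qed
qed

section \<open>Factorization of positive semidefinite kernels\<close>

lemma psd_infmat_sym: "psd_infmat K \<Longrightarrow> K u v = K v u"
  by (auto simp: psd_infmat_def psd_submatrix_def dest!: spec[of _ "{u, v}"])

lemma psd_infmat_nonneg: "psd_infmat K \<Longrightarrow> finite F \<Longrightarrow> 0 \<le> (\<Sum>u\<in>F. \<Sum>v\<in>F. c u * K u v * c v)"
  by (simp add: psd_infmat_def psd_submatrix_def)

lemma psd_infmat_diag_nonneg: "psd_infmat K \<Longrightarrow> 0 \<le> K w w"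
  using psd_infmat_nonneg[of K "{w}" "\<lambda>_. 1"] by simp

text \<open>The quadratic form at the sum and at the difference of two unit vectors bounds
  \<open>K u v\<close> from both sides.\<close>

lemma psd_infmat_eq_zero:
  assumes K: "psd_infmat K" and diag: "\<And>w. K w w = 0"
  shows "K u v = 0"
proof (cases "u = v")
  case False
  have "0 \<le> K u v + K v u"
    using psd_infmat_nonneg[OF K, of "{u, v}" "\<lambda>_. 1"] False by (simp add: diag)
  moreover have "0 \<le> - K u v - K v u"
    using psd_infmat_nonneg[OF K, of "{u, v}" "\<lambda>w. if w = u then 1 else - 1"] False by (simp add: diag)
  ultimately show ?thesis using psd_infmat_sym[OF K, of u v] by simp
qed (simp add: diag)

text \<open>The form of the Schur complement at \<open>c\<close> is the form of \<open>K\<close> at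
  the vector obtained from \<open>c\<close> by adding to its coefficient at \<open>w\<close> the
  number \<open>s\<close> that minimizes the result.\<close>

lemma psd_infmat_schur_complement:
  assumes K: "psd_infmat K" and w: "K w w \<noteq> 0"
  shows "psd_infmat (\<lambda>u v. K u v - K u w * K v w / K w w)"
  unfolding psd_infmat_def psd_submatrix_def
proof (intro allI impI conjI ballI)
  fix u v
  show "K u v - K u w * K v w / K w w = K v u - K v w * K u w / K w w"
    using psd_infmat_sym[OF K, of u v] by simp
next
  fix F :: "'a set" and c :: "'a \<Rightarrow> real"
  assume F: "finite F"
  define r where "r = (\<Sum>u\<in>F. c u * K u w)"
  define s where "s = - r / K w w"
  \<comment> \<open>\<open>w\<close> may or may not lie in \<open>F\<close>; the two guarded terms
    cover both cases.\<close>
  define c' where "c' u = of_bool (u \<in> F) * c u + of_bool (u = w) * s" for u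
  have ext: "(\<Sum>u\<in>insert w F. c' u * h u) = (\<Sum>u\<in>F. c u * h u) + s * h w" for h :: "'a \<Rightarrow> real"
  proof -
    have "(\<Sum>u\<in>insert w F. c' u * h u) =
        (\<Sum>u\<in>insert w F. of_bool (u \<in> F) * c u * h u) + (\<Sum>u\<in>insert w F. of_bool (u = w) * s * h u)"
      by (simp add: c'_def algebra_simps sum.distrib)
    also have "(\<Sum>u\<in>insert w F. of_bool (u \<in> F) * c u * h u) = (\<Sum>u\<in>F. c u * h u)"
      using F by (intro sum.mono_neutral_cong_right) auto
    also have "(\<Sum>u\<in>insert w F. of_bool (u = w) * s * h u) = s * h w"
      using F by (subst sum.remove[of _ w]) auto
    finally show ?thesis .
  qed
  have r': "(\<Sum>v\<in>F. c v * K w v) = r"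
    unfolding r_def by (intro sum.cong) (simp_all add: psd_infmat_sym[OF K, of w])
  have "0 \<le> (\<Sum>u\<in>insert w F. \<Sum>v\<in>insert w F. c' u * K u v * c' v)"
    using F by (intro psd_infmat_nonneg[OF K]) simp
  also have "\<dots> = (\<Sum>u\<in>insert w F. c' u * (\<Sum>v\<in>insert w F. c' v * K u v))"
    by (simp only: sum_distrib_left ac_simps)
  also have "\<dots> = (\<Sum>u\<in>F. c u * ((\<Sum>v\<in>F. c v * K u v) + s * K u w)) + s * (r + s * K w w)"
    by (simp only: ext r')
  also have "\<dots> = (\<Sum>u\<in>F. \<Sum>v\<in>F. c u * K u v * c v) + s * r + s * (r + s * K w w)"
    by (simp add: r_def sum_distrib_left sum.distrib algebra_simps)
  also have "\<dots> = (\<Sum>u\<in>F. \<Sum>v\<in>F. c u * K u v * c v) - r * r / K w w"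
    using w by (simp add: s_def field_simps)
  also have "r * r / K w w = (\<Sum>u\<in>F. \<Sum>v\<in>F. c u * (K u w * K v w / K w w) * c v)"
    by (simp add: r_def sum_product sum_divide_distrib ac_simps)
  finally show "0 \<le> (\<Sum>u\<in>F. \<Sum>v\<in>F. c u * (K u v - K u w * K v w / K w w) * c v)"
    by (simp add: algebra_simps sum_subtractf)
qed

text \<open>Cholesky factorization by successive Schur complements. The dual functionals \<open>\<alpha>\<close>, finitely
  supported on \<open>V\<close>, certify that the factors are linearly independent.\<close>

lemma psd_infmat_factorization:
  fixes K :: "'a \<Rightarrow> 'a \<Rightarrow> real"
  assumes "psd_infmat K" "finite B" "infmat_columns K \<subseteq> span B"
  shows "\<exists>N f V \<alpha>. N \<le> card B \<and> (\<forall>u v. K u v = (\<Sum>k<N. f k u * f k v)) \<and> finite V \<and>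
    (\<forall>k<N. \<forall>l<N. (\<Sum>v\<in>V. \<alpha> k v * f l v) = of_bool (k = l))"
  using assms
proof (induction "card B" arbitrary: K B rule: less_induct)
  case less
  note K = less.prems(1)
  show ?case
  proof (cases "\<forall>w. K w w = 0")
    case True
    then show ?thesis using psd_infmat_eq_zero[OF K] by (intro exI[of _ 0]) (auto intro!: exI[of _ "{}"])
  next
    case False
    then obtain w where w: "K w w \<noteq> 0" by blast
    then have wpos: "0 < K w w" using psd_infmat_diag_nonneg[OF K, of w] by simp
    define K' where "K' u v = K u v - K u w * K v w / K w w" for u v
    have K': "psd_infmat K'"
      using psd_infmat_schur_complement[OF K w] by (simp add: K'_def[abs_def])
    have col: "(\<lambda>u. K u v) \<in> span B" for v
      using less.prems(3) by (auto simp: infmat_columns_def)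
    have "(\<lambda>u. K' u v) = (\<lambda>u. K u v) - (K v w / K w w) *\<^sub>R (\<lambda>u. K u w)" for v
      by (simp add: K'_def fun_eq_iff scaleR_fun_def)
    then have col': "infmat_columns K' \<subseteq> span B"
      by (auto simp: infmat_columns_def intro!: span_diff span_scale col)
    obtain B' where B': "B' \<subseteq> infmat_columns K'" "independent B'" "infmat_columns K' \<subseteq> span B'"
      using maximal_independent_subset by blast
    have vanish: "subspace {h :: 'a \<Rightarrow> real. h w = 0}"
      by (auto simp: subspace_def scaleR_fun_def)
    \<comment> \<open>Elimination clears row \<open>w\<close>, so all of \<open>span B'\<close>
      vanishes at \<open>w\<close>, unlike column \<open>w\<close> of \<open>K\<close>. That column
      is thus independent of \<open>B'\<close>, and \<open>B'\<close> is smaller than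
      \<open>B\<close>.\<close>
    have "K' w v = 0" for v
      using w psd_infmat_sym[OF K, of w v] by (simp add: K'_def)
    then have "B' \<subseteq> {h. h w = 0}"
      using B'(1) by (auto simp: infmat_columns_def)
    then have "span B' \<subseteq> {h. h w = 0}"
      using vanish by (rule span_minimal)
    then have notin: "(\<lambda>u. K u w) \<notin> span B'" using w by auto
    then have "independent (insert (\<lambda>u. K u w) B')"
      using B'(2) by (rule independent_insertI)
    moreover have "insert (\<lambda>u. K u w) B' \<subseteq> span B"
      using B'(1) col' col by auto
    ultimately have "finite (insert (\<lambda>u. K u w) B') \<and> card (insert (\<lambda>u. K u w) B') \<le> card B"
      by (rule independent_span_bound[OF less.prems(2)])
    moreover have "(\<lambda>u. K u w) \<notin> B'" using notin span_base by blast
    ultimately have fin: "finite B'" and card: "Suc (card B') \<le> card B" by auto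
    have "card B' < card B" using card by simp
    from less.hyps[OF this K' fin B'(3)] obtain N f V \<alpha> where N: "N \<le> card B'"
      and f: "\<forall>u v. K' u v = (\<Sum>k<N. f k u * f k v)" and V: "finite V"
      and \<alpha>: "\<forall>k<N. \<forall>l<N. (\<Sum>v\<in>V. \<alpha> k v * f l v) = of_bool (k = l)"
      by blast
    \<comment> \<open>The new factor: \<open>p u * p v\<close> is the rank one kernel that was
      subtracted to form \<open>K'\<close>.\<close>
    define p where "p u = K u w / sqrt (K w w)" for u
    define f' where "f' = f(N := p)"
    have f'_lt: "f' k = f k" if "k < N" for k using that by (simp add: f'_def)
    have f'_N: "f' N = p" by (simp add: f'_def)
    have fw: "f k w = 0" if "k < N" for k
    proof -
      have "(\<Sum>k<N. f k w * f k w) = 0" using f[rule_format, of w w] w by (simp add: K'_def)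
      then show ?thesis using that by (subst (asm) sum_nonneg_eq_0_iff) auto
    qed
    have pw: "p w \<noteq> 0" using w wpos by (simp add: p_def)
    \<comment> \<open>The old factors vanish at \<open>w\<close>, so evaluation at \<open>w\<close>
      divided by \<open>p w\<close> is dual to \<open>p\<close>. Multiples of it correct the old
      functionals so that they annihilate \<open>p\<close>.\<close>
    define \<beta> where "\<beta> k v = (if k < N then of_bool (v \<in> V) * \<alpha> k v - of_bool (v = w) * ((\<Sum>x\<in>V. \<alpha> k x * p x) / p w)
      else of_bool (v = w) / p w)" for k v
    have at_w: "(\<Sum>v\<in>insert w V. of_bool (v = w) * h v) = h w" for h :: "'a \<Rightarrow> real"
      using V by (subst sum.remove[of _ w]) auto
    have on_V: "(\<Sum>v\<in>insert w V. of_bool (v \<in> V) * h v) = (\<Sum>v\<in>V. h v)" for h :: "'a \<Rightarrow> real"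
      using V by (intro sum.mono_neutral_cong_right) auto
    have \<beta>_lt: "(\<Sum>v\<in>insert w V. \<beta> k v * h v) = (\<Sum>v\<in>V. \<alpha> k v * h v) - (\<Sum>x\<in>V. \<alpha> k x * p x) / p w * h w"
      if "k < N" for k h
    proof -
      have "(\<Sum>v\<in>insert w V. \<beta> k v * h v) = (\<Sum>v\<in>insert w V. of_bool (v \<in> V) * (\<alpha> k v * h v)
          - of_bool (v = w) * ((\<Sum>x\<in>V. \<alpha> k x * p x) / p w * h v))"
        using that by (intro sum.cong) (simp_all add: \<beta>_def left_diff_distrib)
      then show ?thesis by (simp only: sum_subtractf at_w on_V)
    qed
    have \<beta>_N: "(\<Sum>v\<in>insert w V. \<beta> N v * h v) = h w / p w" for h
      using at_w[of "\<lambda>v. h v / p w"] by (simp add: \<beta>_def)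
    show ?thesis
    proof (rule exI[of _ "Suc N"], rule exI[of _ f'], rule exI[of _ "insert w V"], rule exI[of _ \<beta>], intro conjI)
      show "Suc N \<le> card B" using N card by simp
      show "finite (insert w V)" using V by simp
      show "\<forall>u v. K u v = (\<Sum>k<Suc N. f' k u * f' k v)"
      proof (intro allI)
        fix u v
        have "(\<Sum>k<Suc N. f' k u * f' k v) = K' u v + p u * p v"
          by (simp add: f f'_lt f'_N)
        moreover have "p u * p v = K u w * K v w / K w w"
          using wpos by (simp add: p_def)
        ultimately show "K u v = (\<Sum>k<Suc N. f' k u * f' k v)" by (simp add: K'_def)
      qed
      show "\<forall>k<Suc N. \<forall>l<Suc N. (\<Sum>v\<in>insert w V. \<beta> k v * f' l v) = of_bool (k = l)"
        using pw by (auto simp: less_Suc_eq \<beta>_lt \<beta>_N f'_lt f'_N fw \<alpha>)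
    qed
  qed
qed

section \<open>The algebra of a tracial sequence\<close>

lemma sum_eq_single:
  assumes "finite A" "k \<in> A" "\<And>l. l \<in> A \<Longrightarrow> l \<noteq> k \<Longrightarrow> f l = 0" "f k = c"
  shows "sum f A = c"
  using assms by (subst sum.remove[of _ k]) auto

lemma sum_of_bool_single:
  fixes f :: "'a \<Rightarrow> real"
  assumes "finite A" "k \<in> A"
  shows "(\<Sum>l\<in>A. of_bool (k = l) * f l) = f k"
  by (rule sum_eq_single[OF assms]; simp)+

text \<open>The columns \<open>\<lambda>k. g k w\<close> realize the words as vectors of a Euclidean space whose Gram matrix is
  the tracial moment matrix (the GNS construction); \<open>\<alpha>\<close> makes these vectors span the space.\<close>

locale tracial_gram =
  fixes y :: "'n list \<Rightarrow> real" and N :: nat and g :: "nat \<Rightarrow> 'n list \<Rightarrow> real"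
    and V :: "'n list set" and \<alpha> :: "nat \<Rightarrow> 'n list \<Rightarrow> real"
  assumes cyc: "y (u @ v) = y (v @ u)"
    and gram: "y (rev u @ v) = (\<Sum>k<N. g k u * g k v)"
    and finite_V: "finite V"
    and dual: "k < N \<Longrightarrow> l < N \<Longrightarrow> (\<Sum>v\<in>V. \<alpha> k v * g l v) = of_bool (k = l)"
begin

text \<open>On combinations of the functions \<open>g l\<close> this reads off the
  \<open>k\<close>-th coefficient, so applying it to an identity compares coefficients.\<close>

definition coord :: "nat \<Rightarrow> ('n list \<Rightarrow> real) \<Rightarrow> real"
  where "coord k h = (\<Sum>v\<in>V. \<alpha> k v * h v)"

text \<open>The matrix of left multiplication by \<open>w\<close>, read off from the action of its
  adjoint \<open>rev w\<close>. This way the expansion of \<open>g k (w @ v)\<close> in the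
  \<open>g l v\<close> comes out of the Gram identity and need not be known beforehand.\<close>

definition lmul :: "'n list \<Rightarrow> nat \<Rightarrow> nat \<Rightarrow> real"
  where "lmul w k l = coord k (\<lambda>u. g l (rev w @ u))"

definition rmul :: "'n list \<Rightarrow> nat \<Rightarrow> nat \<Rightarrow> real"
  where "rmul w k l = coord k (\<lambda>u. g l (u @ rev w))"

text \<open>The structure constants of the algebra: \<open>structc m k l\<close> is the \<open>(k, l)\<close> entry of the left
  multiplication by the \<open>m\<close>-th basis vector.\<close>

definition structc :: "nat \<Rightarrow> nat \<Rightarrow> nat \<Rightarrow> real"
  where "structc m k l = coord l (\<lambda>x. rmul x k m)"

definition ltrace :: "'n list \<Rightarrow> real"
  where "ltrace w = (\<Sum>k<N. lmul w k k)"

definition trace_form :: "nat \<Rightarrow> nat \<Rightarrow> real"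
  where "trace_form m m' = (\<Sum>k<N. \<Sum>l<N. structc m k l * structc m' k l)"

section \<open>Matrices of left and right multiplication\<close>

lemma coord_sum: "coord k (\<lambda>u. \<Sum>i\<in>I. h i u * c i) = (\<Sum>i\<in>I. coord k (h i) * c i)"
  unfolding coord_def sum_distrib_left sum_distrib_right by (subst sum.swap) (simp add: ac_simps)

lemma coord_g: "k < N \<Longrightarrow> l < N \<Longrightarrow> coord k (g l) = of_bool (k = l)"
  by (simp add: coord_def dual)

lemma coord_comb: "k < N \<Longrightarrow> coord k (\<lambda>u. \<Sum>l<N. g l u * c l) = c k"
  by (simp add: coord_sum coord_g sum_of_bool_single)

lemma comb_unique:
  assumes "\<And>v. (\<Sum>l<N. c l * g l v) = (\<Sum>l<N. c' l * g l v)" and "k < N"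
  shows "c k = c' k"
  using coord_comb[OF assms(2), of c] coord_comb[OF assms(2), of c'] assms(1) by (simp add: mult.commute)

text \<open>The Gram identities for the pairs \<open>u\<close>, \<open>w @ v\<close> and
  \<open>rev w @ u\<close>, \<open>v\<close> compute the same moment; coefficients are compared in
  \<open>u\<close>.\<close>

lemma g_append_left: "g k (w @ v) = (\<Sum>l<N. lmul w k l * g l v)" if "k < N"
proof -
  have "(\<Sum>k<N. g k u * g k (w @ v)) = (\<Sum>l<N. g l (rev w @ u) * g l v)" for u
    using gram[of u "w @ v"] gram[of "rev w @ u" v] by simp
  then have "coord k (\<lambda>u. \<Sum>k<N. g k u * g k (w @ v)) = coord k (\<lambda>u. \<Sum>l<N. g l (rev w @ u) * g l v)"
    by simp
  then show ?thesis
    unfolding coord_comb[OF that, of "\<lambda>k. g k (w @ v)"] unfolding coord_sum lmul_def .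
qed

text \<open>Here cyclic invariance enters: it moves \<open>w\<close> from the end of
  \<open>rev u @ v @ w\<close> to the front, where it is absorbed into
  \<open>u @ rev w\<close>.\<close>

lemma g_append_right: "g k (v @ w) = (\<Sum>l<N. rmul w k l * g l v)" if "k < N"
proof -
  have "(\<Sum>k<N. g k u * g k (v @ w)) = (\<Sum>l<N. g l (u @ rev w) * g l v)" for u
    using gram[of u "v @ w"] gram[of "u @ rev w" v] cyc[of "rev u @ v" w] by simp
  then have "coord k (\<lambda>u. \<Sum>k<N. g k u * g k (v @ w)) = coord k (\<lambda>u. \<Sum>l<N. g l (u @ rev w) * g l v)"
    by simp
  then show ?thesis
    unfolding coord_comb[OF that, of "\<lambda>k. g k (v @ w)"] unfolding coord_sum rmul_def .
qed

lemma lmul_rev: "lmul (rev w) k l = lmul w l k" if "k < N" "l < N"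
  using coord_comb[OF that(2), of "lmul (rev w) k"]
  by (simp add: lmul_def[of w] g_append_left[OF that(1)] mult.commute)

lemma rmul_rev: "rmul (rev w) k l = rmul w l k" if "k < N" "l < N"
  using coord_comb[OF that(2), of "rmul (rev w) k"]
  by (simp add: rmul_def[of w] g_append_right[OF that(1)] mult.commute)

lemma lmul_unique:
  assumes "\<And>v. g k (w @ v) = (\<Sum>l<N. m l * g l v)" "k < N" "l < N"
  shows "lmul w k l = m l"
  by (rule comb_unique[OF _ assms(3)]) (simp add: assms(1,2) g_append_left[symmetric])

lemma lmul_Nil: "lmul [] k l = of_bool (k = l)" if "k < N" "l < N"
proof (rule lmul_unique[OF _ that])
  show "g k ([] @ v) = (\<Sum>l<N. of_bool (k = l) * g l v)" for v
    using that by (simp add: sum_of_bool_single)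
qed

lemma lmul_append: "lmul (w @ w') k l = (\<Sum>m<N. lmul w k m * lmul w' m l)" if "k < N" "l < N"
proof (rule lmul_unique[OF _ that])
  fix v
  have "g k ((w @ w') @ v) = (\<Sum>m<N. \<Sum>l<N. lmul w k m * lmul w' m l * g l v)"
    using that by (simp add: g_append_left[of k w] g_append_left[of _ w'] sum_distrib_left ac_simps)
  then show "g k ((w @ w') @ v) = (\<Sum>l<N. (\<Sum>m<N. lmul w k m * lmul w' m l) * g l v)"
    unfolding sum_distrib_right by (subst (asm) sum.swap)
qed

text \<open>\<open>g k (w @ x)\<close> expands by left multiplication by \<open>w\<close> and by
  right multiplication by \<open>x\<close>. The second expansion is linear in the vector of
  \<open>w\<close>, hence so is \<open>lmul w\<close>, and the product of words descends to the
  Euclidean space.\<close>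

lemma lmul_structc: "lmul w k l = (\<Sum>m<N. structc m k l * g m w)" if "k < N" "l < N"
proof -
  have "(\<Sum>l<N. g l x * lmul w k l) = (\<Sum>m<N. rmul x k m * g m w)" for x
    using g_append_left[OF that(1), of w x] g_append_right[OF that(1), of w x] by (simp add: mult.commute)
  then have "coord l (\<lambda>x. \<Sum>l<N. g l x * lmul w k l) = coord l (\<lambda>x. \<Sum>m<N. rmul x k m * g m w)"
    by simp
  then show ?thesis
    unfolding coord_comb[OF that(2)] unfolding coord_sum structc_def .
qed

lemma rmul_structc: "rmul x k m = (\<Sum>l<N. structc m k l * g l x)" if "k < N" "m < N"
proof (rule comb_unique[OF _ that(2)])
  fix v
  have "(\<Sum>m<N. rmul x k m * g m v) = (\<Sum>l<N. (\<Sum>m<N. structc m k l * g m v) * g l x)"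
    using g_append_left[OF that(1), of v x] g_append_right[OF that(1), of v x] that by (simp add: lmul_structc)
  also have "\<dots> = (\<Sum>m<N. (\<Sum>l<N. structc m k l * g l x) * g m v)"
    unfolding sum_distrib_right by (subst sum.swap) (simp add: ac_simps)
  finally show "(\<Sum>m<N. rmul x k m * g m v) = (\<Sum>m<N. (\<Sum>l<N. structc m k l * g l x) * g m v)" .
qed

section \<open>The trace form of the left regular representation\<close>

lemma ltrace_append: "ltrace (u @ v) = (\<Sum>k<N. \<Sum>l<N. lmul u k l * lmul v l k)"
  by (simp add: ltrace_def lmul_append)

lemma ltrace_cyc: "ltrace (u @ v) = ltrace (v @ u)"
  unfolding ltrace_append by (subst sum.swap) (simp add: mult.commute)

text \<open>Reversal transposes \<open>lmul u\<close>, and both \<open>lmul u\<close> and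
  \<open>lmul v\<close> are linear in the vectors of the words.\<close>

lemma ltrace_form: "ltrace (rev u @ v) = (\<Sum>m<N. \<Sum>m'<N. g m u * trace_form m m' * g m' v)"
proof -
  have "ltrace (rev u @ v) = (\<Sum>k<N. \<Sum>l<N. lmul u k l * lmul v k l)"
    unfolding ltrace_append by (subst sum.swap) (simp add: lmul_rev)
  also have "\<dots> = (\<Sum>k<N. \<Sum>l<N. \<Sum>m<N. \<Sum>m'<N. (structc m k l * g m u) * (structc m' k l * g m' v))"
    by (simp add: lmul_structc sum_product)
  also have "\<dots> = (\<Sum>k<N. \<Sum>m<N. \<Sum>l<N. \<Sum>m'<N. (structc m k l * g m u) * (structc m' k l * g m' v))"
    by (intro sum.cong refl sum.swap)
  also have "\<dots> = (\<Sum>m<N. \<Sum>k<N. \<Sum>l<N. \<Sum>m'<N. (structc m k l * g m u) * (structc m' k l * g m' v))"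
    by (rule sum.swap)
  also have "\<dots> = (\<Sum>m<N. \<Sum>k<N. \<Sum>m'<N. \<Sum>l<N. (structc m k l * g m u) * (structc m' k l * g m' v))"
    by (intro sum.cong refl sum.swap)
  also have "\<dots> = (\<Sum>m<N. \<Sum>m'<N. \<Sum>k<N. \<Sum>l<N. (structc m k l * g m u) * (structc m' k l * g m' v))"
    by (intro sum.cong refl sum.swap)
  also have "\<dots> = (\<Sum>m<N. \<Sum>m'<N. g m u * trace_form m m' * g m' v)"
    unfolding trace_form_def by (simp add: sum_distrib_left sum_distrib_right ac_simps)
  finally show ?thesis .
qed

lemma trace_form_sym: "trace_form a b = trace_form b a"
  by (simp add: trace_form_def mult.commute)

lemma form_unique:
  assumes "\<And>u v. (\<Sum>m<N. \<Sum>m'<N. g m u * s m m' * g m' v) = (\<Sum>m<N. \<Sum>m'<N. g m u * s' m m' * g m' v)"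
    and "k < N" "l < N"
  shows "s k l = s' k l"
proof -
  have *: "(\<Sum>m<N. g m u * s m l) = (\<Sum>m<N. g m u * s' m l)" for u
  proof (rule comb_unique[OF _ assms(3)])
    show "(\<Sum>l<N. (\<Sum>m<N. g m u * s m l) * g l v) = (\<Sum>l<N. (\<Sum>m<N. g m u * s' m l) * g l v)" for v
      using assms(1)[of u v] unfolding sum_distrib_right by (subst (1 2) sum.swap)
  qed
  show ?thesis
    by (rule comb_unique[OF _ assms(2)]) (use * in \<open>simp add: mult.commute\<close>)
qed

text \<open>Passage to an orthonormal eigenbasis of the trace form. The orthogonal change of
  coordinates preserves the Gram identity and the duality; it conjugates the left multiplications,
  so their traces stay the same.\<close>

lemma rotate:
  assumes Q1: "\<And>k l. k < N \<Longrightarrow> l < N \<Longrightarrow> (\<Sum>a<N. Q a k * Q a l) = of_bool (k = l)"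
    and Q2: "\<And>a b. a < N \<Longrightarrow> b < N \<Longrightarrow> (\<Sum>k<N. Q a k * Q b k) = of_bool (a = b)"
    and diag: "\<And>k l. k < N \<Longrightarrow> l < N \<Longrightarrow> (\<Sum>a<N. \<Sum>b<N. Q a k * trace_form a b * Q b l) = of_bool (k = l) * d k"
  defines "g' \<equiv> \<lambda>k w. \<Sum>a<N. Q a k * g a w"
    and "\<alpha>' \<equiv> \<lambda>k v. \<Sum>a<N. Q a k * \<alpha> a v"
  shows "tracial_gram y N g' V \<alpha>'"
    and "ltrace (rev u @ v) = (\<Sum>m<N. d m * g' m u * g' m v)"
    and "ltrace w = tracial_gram.ltrace N g' V \<alpha>' w"
proof -
  have g': "g' k w = (\<Sum>a<N. Q a k * g a w)" for k w by (simp add: g'_def)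
  have g_rotate: "g a w = (\<Sum>k<N. Q a k * g' k w)" if "a < N" for a w
  proof -
    have "(\<Sum>k<N. Q a k * g' k w) = (\<Sum>b<N. (\<Sum>k<N. Q a k * Q b k) * g b w)"
      unfolding g' sum_distrib_left sum_distrib_right by (subst sum.swap) (simp add: ac_simps)
    also have "\<dots> = g a w" using that by (simp add: Q2 sum_of_bool_single)
    finally show ?thesis by simp
  qed
  show fr: "tracial_gram y N g' V \<alpha>'"
  proof
    show "y (u @ v) = y (v @ u)" for u v by (rule cyc)
    show "finite V" by (rule finite_V)
    show "y (rev u @ v) = (\<Sum>k<N. g' k u * g' k v)" for u v
    proof -
      have "y (rev u @ v) = (\<Sum>a<N. \<Sum>k<N. Q a k * g' k u * g a v)"
        by (simp add: gram g_rotate[of _ u] sum_distrib_right)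
      also have "\<dots> = (\<Sum>k<N. g' k u * g' k v)"
        unfolding g'[of _ v] by (subst sum.swap) (simp add: sum_distrib_left ac_simps g'[of _ v])
      finally show ?thesis .
    qed
    show "(\<Sum>v\<in>V. \<alpha>' k v * g' l v) = of_bool (k = l)" if "k < N" "l < N" for k l
    proof -
      have "(\<Sum>v\<in>V. \<alpha>' k v * g' l v) = (\<Sum>v\<in>V. \<Sum>a<N. \<Sum>b<N. Q a k * \<alpha> a v * (Q b l * g b v))"
        by (simp add: \<alpha>'_def g' sum_product)
      also have "\<dots> = (\<Sum>a<N. \<Sum>b<N. \<Sum>v\<in>V. Q a k * \<alpha> a v * (Q b l * g b v))"
        by (subst sum.swap) (intro sum.cong refl sum.swap)
      also have "\<dots> = (\<Sum>a<N. \<Sum>b<N. Q a k * Q b l * (\<Sum>v\<in>V. \<alpha> a v * g b v))"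
        by (simp add: sum_distrib_left ac_simps)
      also have "\<dots> = (\<Sum>a<N. \<Sum>b<N. Q a k * Q b l * of_bool (a = b))"
        by (simp add: dual)
      also have "\<dots> = (\<Sum>a<N. Q a k * Q a l)"
        by (intro sum.cong refl, rename_tac a, rule_tac k = a in sum_eq_single) auto
      finally show ?thesis using that by (simp add: Q1)
    qed
  qed
  interpret r: tracial_gram y N g' V \<alpha>' by (rule fr)
  show "ltrace (rev u @ v) = (\<Sum>m<N. d m * g' m u * g' m v)"
  proof -
    have "ltrace (rev u @ v) = (\<Sum>a<N. \<Sum>b<N. (\<Sum>k<N. Q a k * g' k u) * trace_form a b * (\<Sum>l<N. Q b l * g' l v))"
      unfolding ltrace_form by (intro sum.cong refl) (simp add: g_rotate)
    also have "\<dots> = (\<Sum>a<N. \<Sum>b<N. \<Sum>k<N. \<Sum>l<N. g' k u * (Q a k * trace_form a b * Q b l) * g' l v)"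
      by (simp add: sum_distrib_left sum_distrib_right ac_simps)
    also have "\<dots> = (\<Sum>a<N. \<Sum>k<N. \<Sum>b<N. \<Sum>l<N. g' k u * (Q a k * trace_form a b * Q b l) * g' l v)"
      by (intro sum.cong refl sum.swap)
    also have "\<dots> = (\<Sum>k<N. \<Sum>a<N. \<Sum>b<N. \<Sum>l<N. g' k u * (Q a k * trace_form a b * Q b l) * g' l v)"
      by (rule sum.swap)
    also have "\<dots> = (\<Sum>k<N. \<Sum>a<N. \<Sum>l<N. \<Sum>b<N. g' k u * (Q a k * trace_form a b * Q b l) * g' l v)"
      by (intro sum.cong refl sum.swap)
    also have "\<dots> = (\<Sum>k<N. \<Sum>l<N. \<Sum>a<N. \<Sum>b<N. g' k u * (Q a k * trace_form a b * Q b l) * g' l v)"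
      by (intro sum.cong refl sum.swap)
    also have "\<dots> = (\<Sum>k<N. \<Sum>l<N. g' k u * (of_bool (k = l) * d k) * g' l v)"
      by (intro sum.cong refl) (simp add: diag[symmetric] sum_distrib_left sum_distrib_right)
    also have "\<dots> = (\<Sum>k<N. d k * g' k u * g' k v)"
      by (intro sum.cong refl, rename_tac k, rule_tac k = k in sum_eq_single) auto
    finally show ?thesis .
  qed
  show "ltrace w = r.ltrace w"
  proof -
    have "r.lmul w k l = (\<Sum>a<N. \<Sum>b<N. Q a k * lmul w a b * Q b l)" if "k < N" "l < N" for k l
    proof (rule r.lmul_unique[OF _ that])
      fix v
      have "g' k (w @ v) = (\<Sum>a<N. Q a k * (\<Sum>b<N. lmul w a b * (\<Sum>l<N. Q b l * g' l v)))"
        unfolding g'[of k] by (intro sum.cong refl) (simp add: g_append_left g_rotate[of _ v])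
      also have "\<dots> = (\<Sum>a<N. \<Sum>b<N. \<Sum>l<N. Q a k * lmul w a b * Q b l * g' l v)"
        by (simp add: sum_distrib_left ac_simps)
      also have "\<dots> = (\<Sum>a<N. \<Sum>l<N. \<Sum>b<N. Q a k * lmul w a b * Q b l * g' l v)"
        by (intro sum.cong refl sum.swap)
      also have "\<dots> = (\<Sum>l<N. \<Sum>a<N. \<Sum>b<N. Q a k * lmul w a b * Q b l * g' l v)"
        by (rule sum.swap)
      finally show "g' k (w @ v) = (\<Sum>l<N. (\<Sum>a<N. \<Sum>b<N. Q a k * lmul w a b * Q b l) * g' l v)"
        by (simp only: sum_distrib_right)
    qed
    then have "r.ltrace w = (\<Sum>k<N. \<Sum>a<N. \<Sum>b<N. Q a k * lmul w a b * Q b k)"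
      by (simp add: r.ltrace_def)
    also have "\<dots> = (\<Sum>a<N. \<Sum>k<N. \<Sum>b<N. Q a k * lmul w a b * Q b k)"
      by (rule sum.swap)
    also have "\<dots> = (\<Sum>a<N. \<Sum>b<N. \<Sum>k<N. Q a k * lmul w a b * Q b k)"
      by (intro sum.cong refl sum.swap)
    also have "\<dots> = (\<Sum>a<N. \<Sum>b<N. lmul w a b * (\<Sum>k<N. Q a k * Q b k))"
      by (simp add: sum_distrib_left ac_simps)
    also have "\<dots> = (\<Sum>a<N. \<Sum>b<N. lmul w a b * of_bool (a = b))"
      by (simp add: Q2)
    also have "\<dots> = ltrace w"
      unfolding ltrace_def by (intro sum.cong refl, rename_tac k, rule_tac k = k in sum_eq_single) auto
    finally show ?thesis by simp
  qed
qed

end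

section \<open>Decomposition by the eigenvalues of the trace form\<close>

locale diagonal_tracial_gram = tracial_gram +
  fixes d :: "nat \<Rightarrow> real"
  assumes ltrace_diag: "ltrace (rev u @ v) = (\<Sum>m<N. d m * g m u * g m v)"
begin

lemma trace_form_diag: "trace_form k l = of_bool (k = l) * d k" if "k < N" "l < N"
proof (rule form_unique[OF _ that])
  fix u v
  have "(\<Sum>m<N. \<Sum>m'<N. g m u * (of_bool (m = m') * d m) * g m' v) = ltrace (rev u @ v)"
    unfolding ltrace_diag by (intro sum.cong refl, rename_tac k, rule_tac k = k in sum_eq_single) auto
  then show "(\<Sum>m<N. \<Sum>m'<N. g m u * trace_form m m' * g m' v) =
      (\<Sum>m<N. \<Sum>m'<N. g m u * (of_bool (m = m') * d m) * g m' v)"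
    by (simp add: ltrace_form)
qed

text \<open>In the trace form, \<open>w\<close> moves to the other argument as \<open>rev w\<close>,
  so \<open>lmul w\<close> commutes with the diagonal matrix of \<open>d\<close>. Its entries
  between different eigenvalues therefore vanish.\<close>

lemma lmul_commute: "d k * lmul w k l = lmul w k l * d l" if "k < N" "l < N"
proof (rule form_unique[OF _ that])
  fix u v
  have "(\<Sum>m<N. \<Sum>m'<N. g m u * (d m * lmul w m m') * g m' v) = (\<Sum>m<N. d m * g m u * g m (w @ v))"
    by (simp add: g_append_left sum_distrib_left ac_simps)
  also have "\<dots> = (\<Sum>m<N. d m * g m (rev w @ u) * g m v)"
    using ltrace_diag[of u "w @ v"] ltrace_diag[of "rev w @ u" v] by simp
  also have "\<dots> = (\<Sum>m'<N. \<Sum>m<N. g m u * (lmul w m m' * d m') * g m' v)"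
    by (simp add: g_append_left[of _ "rev w"] lmul_rev sum_distrib_left sum_distrib_right ac_simps)
  finally show "(\<Sum>m<N. \<Sum>m'<N. g m u * (d m * lmul w m m') * g m' v) =
      (\<Sum>m<N. \<Sum>m'<N. g m u * (lmul w m m' * d m') * g m' v)"
    by (subst (2) sum.swap)
qed

text \<open>The right-handed version uses that \<open>ltrace\<close> is cyclic. Together with
  \<open>lmul_commute\<close> it makes the eigenspaces two-sided ideals.\<close>

lemma rmul_commute: "d k * rmul w k l = rmul w k l * d l" if "k < N" "l < N"
proof (rule form_unique[OF _ that])
  fix u v
  have "(\<Sum>m<N. \<Sum>m'<N. g m u * (d m * rmul w m m') * g m' v) = (\<Sum>m<N. d m * g m u * g m (v @ w))"
    by (simp add: g_append_right sum_distrib_left ac_simps)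
  also have "\<dots> = (\<Sum>m<N. d m * g m (u @ rev w) * g m v)"
    using ltrace_diag[of u "v @ w"] ltrace_diag[of "u @ rev w" v] ltrace_cyc[of "rev u @ v" w] by simp
  also have "\<dots> = (\<Sum>m'<N. \<Sum>m<N. g m u * (rmul w m m' * d m') * g m' v)"
    by (simp add: g_append_right[of _ _ "rev w"] rmul_rev sum_distrib_left sum_distrib_right ac_simps)
  finally show "(\<Sum>m<N. \<Sum>m'<N. g m u * (d m * rmul w m m') * g m' v) =
      (\<Sum>m<N. \<Sum>m'<N. g m u * (rmul w m m' * d m') * g m' v)"
    by (subst (2) sum.swap)
qed

text \<open>Indexes the orthonormal basis of the ideal \<open>E\<^sub>\<mu>\<close>.\<close>

definition block :: "real \<Rightarrow> nat set"
  where "block \<mu> = {k. k < N \<and> d k = \<mu>}"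

lemma block_subset: "block \<mu> \<subseteq> {..<N}"
  by (auto simp: block_def)

lemma finite_block: "finite (block \<mu>)"
  by (simp add: block_def)

text \<open>The unit element of the ideal belonging to the eigenvalue \<open>\<mu>\<close> acts from the left as the
  orthogonal projection onto that ideal.\<close>

lemma block_unit:
  assumes "k < N" "l < N"
  shows "(\<Sum>m\<in>block \<mu>. g m [] * structc m k l) = of_bool (k = l \<and> k \<in> block \<mu>)"
proof (rule comb_unique[OF _ assms(2)])
  fix x
  have "(\<Sum>l<N. (\<Sum>m\<in>block \<mu>. g m [] * structc m k l) * g l x) =
      (\<Sum>m\<in>block \<mu>. g m [] * (\<Sum>l<N. structc m k l * g l x))"
    unfolding sum_distrib_left sum_distrib_right by (subst sum.swap) (simp add: ac_simps)
  also have "\<dots> = (\<Sum>m\<in>block \<mu>. rmul x k m * g m [])"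
    using assms(1) block_subset by (intro sum.cong refl) (auto simp: rmul_structc block_def)
  also have "\<dots> = of_bool (k \<in> block \<mu>) * g k x"
  proof (cases "k \<in> block \<mu>")
    case True
    \<comment> \<open>Right multiplication does not mix blocks, so the sum extends to all
      coordinates and becomes the \<open>k\<close>-th coordinate of the empty word times
      \<open>x\<close>.\<close>
    have "(\<Sum>m\<in>block \<mu>. rmul x k m * g m []) = (\<Sum>m<N. rmul x k m * g m [])"
    proof (intro sum.mono_neutral_left block_subset ballI)
      fix m assume "m \<in> {..<N} - block \<mu>"
      then show "rmul x k m * g m [] = 0"
        using True rmul_commute[OF assms(1), of m x] by (auto simp: block_def)
    qed simp
    then show ?thesis using True g_append_right[OF assms(1), of "[]" x] by simp
  next
    case False
    have "rmul x k m = 0" if "m \<in> block \<mu>" for m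
      using False that rmul_commute[OF assms(1), of m x] assms(1) by (auto simp: block_def)
    then show ?thesis using False by simp
  qed
  also have "\<dots> = (\<Sum>l<N. of_bool (k = l \<and> k \<in> block \<mu>) * g l x)"
    using assms(1) by (subst sum.remove[of _ k]) auto
  finally show "(\<Sum>l<N. (\<Sum>m\<in>block \<mu>. g m [] * structc m k l) * g l x) =
      (\<Sum>l<N. of_bool (k = l \<and> k \<in> block \<mu>) * g l x)" .
qed

text \<open>The projection onto the block is the left multiplication by its unit, so the partial
  trace is the trace form of that unit and \<open>w\<close>. Diagonality turns it into \<mu> times
  their inner product.\<close>

lemma block_trace: "(\<Sum>k\<in>block \<mu>. lmul w k k) = \<mu> * (\<Sum>k\<in>block \<mu>. g k [] * g k w)"
proof -
  have "(\<Sum>k\<in>block \<mu>. lmul w k k) = (\<Sum>k<N. of_bool (k \<in> block \<mu>) * lmul w k k)"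
    using block_subset by (intro sum.mono_neutral_cong_left) auto
  also have "\<dots> = (\<Sum>k<N. \<Sum>l<N. of_bool (k = l \<and> k \<in> block \<mu>) * lmul w k l)"
    by (intro sum.cong refl) (simp add: of_bool_conj sum_of_bool_single mult.assoc)
  also have "\<dots> = (\<Sum>k<N. \<Sum>l<N. (\<Sum>m\<in>block \<mu>. g m [] * structc m k l) * (\<Sum>m'<N. structc m' k l * g m' w))"
    by (intro sum.cong refl) (simp add: block_unit lmul_structc)
  also have "\<dots> = (\<Sum>k<N. \<Sum>l<N. \<Sum>m\<in>block \<mu>. \<Sum>m'<N. g m [] * structc m k l * (structc m' k l * g m' w))"
    by (simp only: sum_product)
  also have "\<dots> = (\<Sum>k<N. \<Sum>m\<in>block \<mu>. \<Sum>l<N. \<Sum>m'<N. g m [] * structc m k l * (structc m' k l * g m' w))"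
    by (intro sum.cong refl sum.swap)
  also have "\<dots> = (\<Sum>m\<in>block \<mu>. \<Sum>k<N. \<Sum>l<N. \<Sum>m'<N. g m [] * structc m k l * (structc m' k l * g m' w))"
    by (rule sum.swap)
  also have "\<dots> = (\<Sum>m\<in>block \<mu>. \<Sum>k<N. \<Sum>m'<N. \<Sum>l<N. g m [] * structc m k l * (structc m' k l * g m' w))"
    by (intro sum.cong refl sum.swap)
  also have "\<dots> = (\<Sum>m\<in>block \<mu>. \<Sum>m'<N. \<Sum>k<N. \<Sum>l<N. g m [] * structc m k l * (structc m' k l * g m' w))"
    by (intro sum.cong refl sum.swap)
  also have "\<dots> = (\<Sum>m\<in>block \<mu>. \<Sum>m'<N. g m [] * trace_form m m' * g m' w)"
    unfolding trace_form_def by (simp add: sum_distrib_left sum_distrib_right ac_simps)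
  also have "\<dots> = (\<Sum>m\<in>block \<mu>. \<mu> * (g m [] * g m w))"
  proof (intro sum.cong refl)
    fix m assume m: "m \<in> block \<mu>"
    then have "m < N" "d m = \<mu>" by (auto simp: block_def)
    then show "(\<Sum>m'<N. g m [] * trace_form m m' * g m' w) = \<mu> * (g m [] * g m w)"
      by (subst sum.remove[of _ m]) (auto simp: trace_form_diag)
  qed
  finally show ?thesis by (simp only: sum_distrib_left)
qed

text \<open>The matrices \<open>A\<close> are the left multiplications by letters, restricted to the
  block. By \<open>block_trace\<close> the trace of a word is a multiple of the wanted inner
  product, and the empty word determines the factor.\<close>

lemma block_moments:
  assumes \<mu>: "\<mu> \<in> d ` {..<N}"
  shows "\<exists>s l A. 0 < s \<and> s \<le> N \<and> 0 \<le> l \<and> (\<forall>j. A j \<in> sym_mats s) \<and>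
    (\<Sum>k\<in>block \<mu>. g k [] * g k []) = l \<and>
    (\<forall>w. (\<Sum>k\<in>block \<mu>. g k [] * g k w) = l * normalized_trace (word_eval s A w))"
proof -
  define s where "s = card (block \<mu>)"
  define l where "l = (\<Sum>k\<in>block \<mu>. g k [] * g k [])"
  have s: "0 < s" using \<mu> by (auto simp: s_def card_gt_0_iff finite_block) (auto simp: block_def)
  have sN: "s \<le> N" using card_mono[OF _ block_subset, of \<mu>] by (simp add: s_def)
  obtain e where "bij_betw e {0..<s} (block \<mu>)"
    using ex_bij_betw_nat_finite[OF finite_block[of \<mu>]] unfolding s_def by blast
  then have e: "bij_betw e {..<s} (block \<mu>)" by (simp add: lessThan_atLeast0)
  have e_block: "e p \<in> block \<mu>" if "p < s" for p using e that by (auto simp: bij_betw_def)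
  have eN: "e p < N" if "p < s" for p using e_block[OF that] by (simp add: block_def)
  have e_eq: "e p = e q \<longleftrightarrow> p = q" if "p < s" "q < s" for p q
    using e that by (auto simp: bij_betw_def inj_on_def)
  define A where "A j = mat s s (\<lambda>(p, q). lmul [j] (e p) (e q))" for j
  have A_sym: "A j \<in> sym_mats s" for j
    unfolding sym_mats_def A_def using lmul_rev[of _ _ "[j]"] eN by (auto intro!: eq_matI)
  have eval: "word_eval s A w = mat s s (\<lambda>(p, q). lmul w (e p) (e q))" for w
  proof (induction w)
    case Nil
    show ?case by (intro eq_matI) (auto simp: lmul_Nil eN e_eq)
  next
    case (Cons x w)
    have "lmul (x # w) (e p) (e q) = (\<Sum>r<s. lmul [x] (e p) (e r) * lmul w (e r) (e q))"
      if pq: "p < s" "q < s" for p q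
    proof -
      have "lmul (x # w) (e p) (e q) = (\<Sum>m<N. lmul [x] (e p) m * lmul w m (e q))"
        using lmul_append[of "e p" "e q" "[x]" w] pq eN by simp
      \<comment> \<open>Entries leading out of the block vanish, so restriction to the block is
        multiplicative.\<close>
      also have "\<dots> = (\<Sum>m\<in>block \<mu>. lmul [x] (e p) m * lmul w m (e q))"
      proof (intro sum.mono_neutral_right block_subset ballI)
        fix m assume "m \<in> {..<N} - block \<mu>"
        then show "lmul [x] (e p) m * lmul w m (e q) = 0"
          using e_block[OF pq(1)] lmul_commute[of "e p" m "[x]"] by (auto simp: block_def)
      qed simp
      also have "\<dots> = (\<Sum>r<s. lmul [x] (e p) (e r) * lmul w (e r) (e q))"
        by (rule sum.reindex_bij_betw[OF e, symmetric])
      finally show ?thesis .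
    qed
    then show ?case
      unfolding word_eval.simps Cons.IH unfolding A_def
      by (intro eq_matI) (auto simp: scalar_prod_def lessThan_atLeast0)
  qed
  have trace: "normalized_trace (word_eval s A w) = \<mu> * (\<Sum>k\<in>block \<mu>. g k [] * g k w) / s" for w
  proof -
    have "(\<Sum>p<s. lmul w (e p) (e p)) = (\<Sum>k\<in>block \<mu>. lmul w k k)"
      by (rule sum.reindex_bij_betw[OF e])
    then show ?thesis by (simp add: normalized_trace_def eval block_trace)
  qed
  \<comment> \<open>The empty word evaluates to the identity, which links weight and size by
    \<open>\<mu> * l = s\<close>.\<close>
  have "normalized_trace (word_eval s A []) = 1"
    using s by (simp add: normalized_trace_def)
  then have \<mu>l: "\<mu> * l = s"
    using trace[of "[]"] s by (simp add: l_def field_simps)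
  have "l * normalized_trace (word_eval s A w) = (\<Sum>k\<in>block \<mu>. g k [] * g k w)" for w
  proof -
    have "l * normalized_trace (word_eval s A w) = \<mu> * l * (\<Sum>k\<in>block \<mu>. g k [] * g k w) / s"
      by (simp only: trace times_divide_eq_right mult.assoc mult.left_commute)
    then show ?thesis using s by (simp add: \<mu>l)
  qed
  moreover have "0 \<le> l" by (simp add: l_def sum_nonneg)
  ultimately show ?thesis using s sN A_sym
    by (intro exI[of _ s] exI[of _ l] exI[of _ A]) (simp add: l_def[symmetric])
qed

text \<open>The Gram identity for the empty word and \<open>w\<close> splits \<open>y w\<close> into
  the contributions of the blocks; at \<open>w = []\<close> it shows that the weights add up to
  1.\<close>

lemma moments:
  assumes y0: "y [] = 1"
  shows "\<exists>(M::nat) s l A. (\<forall>i<M. 0 < s i \<and> s i \<le> N) \<and> (\<forall>i<M. 0 \<le> l i) \<and> (\<Sum>i<M. l i) = 1 \<and>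
    (\<forall>i<M. \<forall>j. A i j \<in> sym_mats (s i)) \<and>
    (\<forall>w. y w = (\<Sum>i<M. l i * normalized_trace (word_eval (s i) (A i) w)))"
proof -
  define D where "D = d ` {..<N}"
  obtain e where "bij_betw e {0..<card D} D"
    using ex_bij_betw_nat_finite[of D] by (auto simp: D_def)
  then have e: "bij_betw e {..<card D} D" by (simp add: lessThan_atLeast0)
  have e_D: "e i \<in> D" if "i < card D" for i using e that by (auto simp: bij_betw_def)
  define R where "R \<mu> s l A \<longleftrightarrow> 0 < s \<and> s \<le> N \<and> 0 \<le> l \<and> (\<forall>j. A j \<in> sym_mats s) \<and>
    (\<Sum>k\<in>block \<mu>. g k [] * g k []) = l \<and>
    (\<forall>w. (\<Sum>k\<in>block \<mu>. g k [] * g k w) = l * normalized_trace (word_eval s A w))" for \<mu> s l A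
  have "\<exists>s l A. R (e i) s l A" if "i < card D" for i
    using block_moments e_D[OF that] by (simp add: R_def D_def)
  then obtain s l A where R: "\<And>i. i < card D \<Longrightarrow> R (e i) (s i) (l i) (A i)"
    by metis
  then have H: "\<And>i. i < card D \<Longrightarrow> 0 < s i \<and> s i \<le> N \<and> 0 \<le> l i \<and>
    (\<forall>j. A i j \<in> sym_mats (s i)) \<and> (\<Sum>k\<in>block (e i). g k [] * g k []) = l i \<and>
    (\<forall>w. (\<Sum>k\<in>block (e i). g k [] * g k w) = l i * normalized_trace (word_eval (s i) (A i) w))"
    by (simp add: R_def)
  have y: "y w = (\<Sum>i<card D. \<Sum>k\<in>block (e i). g k [] * g k w)" for w
  proof -
    have "y w = (\<Sum>k<N. g k [] * g k w)" using gram[of "[]" w] by simp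
    also have "\<dots> = (\<Sum>\<mu>\<in>D. \<Sum>k\<in>block \<mu>. g k [] * g k w)"
      unfolding D_def block_def
      using sum.image_gen[of "{..<N}" "\<lambda>k. g k [] * g k w" d] by (simp only: finite_lessThan lessThan_iff)
    also have "\<dots> = (\<Sum>i<card D. \<Sum>k\<in>block (e i). g k [] * g k w)"
      by (rule sum.reindex_bij_betw[OF e, symmetric])
    finally show ?thesis .
  qed
  have "(\<Sum>i<card D. l i) = 1"
    using y[of "[]"] y0 H by simp
  moreover have "y w = (\<Sum>i<card D. l i * normalized_trace (word_eval (s i) (A i) w))" for w
    unfolding y using H by simp
  ultimately show ?thesis using H
    by (intro exI[of _ "card D"] exI[of _ s] exI[of _ l] exI[of _ A]) blast
qed

end

section \<open>Amplification to a common size\<close>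

text \<open>The block diagonal matrix with \<open>m\<close> copies of \<open>A\<close>. For positive
  \<open>m\<close> normalized traces are unchanged, so tuples of different sizes can be brought to
  the single size that \<open>tracial_moment_sequence\<close> demands.\<close>

primrec amplify :: "nat \<Rightarrow> real mat \<Rightarrow> real mat"
  where
    "amplify 0 A = 1\<^sub>m 0"
  | "amplify (Suc m) A =
      four_block_mat A (0\<^sub>m (dim_row A) (m * dim_row A)) (0\<^sub>m (m * dim_row A) (dim_row A)) (amplify m A)"

lemma amplify_carrier: "A \<in> carrier_mat s s \<Longrightarrow> amplify m A \<in> carrier_mat (m * s) (m * s)"
  by (induction m) auto

lemma amplify_one: "amplify m (1\<^sub>m s) = 1\<^sub>m (m * s)"
  by (induction m) auto

lemma amplify_mult:
  assumes "A \<in> carrier_mat s s" "B \<in> carrier_mat s s"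
  shows "amplify m (A * B) = amplify m A * amplify m B"
proof (induction m)
  case (Suc m)
  note carr = amplify_carrier[OF assms(1), of m] amplify_carrier[OF assms(2), of m]
  show ?case
    using assms carr Suc by (simp add: mult_four_block_mat[of _ s s _ "m * s" _ "m * s" _ _ s _ "m * s"])
qed auto

lemma amplify_transpose:
  assumes "A \<in> carrier_mat s s"
  shows "transpose_mat (amplify m A) = amplify m (transpose_mat A)"
proof (induction m)
  case (Suc m)
  then show ?case
    using assms amplify_carrier[OF assms, of m]
    by (simp add: transpose_four_block_mat[of _ s s _ "m * s" _ "m * s"])
qed auto

lemma word_eval_carrier: "(\<And>j. A j \<in> carrier_mat s s) \<Longrightarrow> word_eval s A w \<in> carrier_mat s s"
  by (induction w) (auto intro: mult_carrier_mat)

lemma word_eval_amplify: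
  assumes "\<And>j. A j \<in> carrier_mat s s"
  shows "word_eval (m * s) (\<lambda>j. amplify m (A j)) w = amplify m (word_eval s A w)"
  by (induction w) (simp_all add: amplify_one amplify_mult[of _ s] word_eval_carrier assms)

lemma sum_lessThan_add: "(\<Sum>i<a + b. f i) = (\<Sum>i<a. f i) + (\<Sum>i<b. f (a + i) :: real)" for a b :: nat
  by (induction b) auto

lemma amplify_diag_sum:
  assumes "A \<in> carrier_mat s s"
  shows "(\<Sum>i<m * s. amplify m A $$ (i, i)) = m * (\<Sum>i<s. A $$ (i, i))"
proof (induction m)
  case (Suc m)
  have "(\<Sum>i<Suc m * s. amplify (Suc m) A $$ (i, i)) = (\<Sum>i<s. A $$ (i, i)) + (\<Sum>i<m * s. amplify m A $$ (i, i))"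
    using assms amplify_carrier[OF assms, of m] by (simp add: sum_lessThan_add)
  then show ?case using Suc by (simp add: algebra_simps)
qed simp

lemma normalized_trace_amplify:
  assumes A: "A \<in> carrier_mat s s" and m: "0 < m"
  shows "normalized_trace (amplify m A) = normalized_trace A"
  using A amplify_carrier[OF A, of m] m by (simp add: normalized_trace_def amplify_diag_sum)

lemma tracial_moment_sequenceI:
  fixes y :: "'n list \<Rightarrow> real" and N :: nat
  assumes s: "\<And>i. i < N \<Longrightarrow> 0 < s i" and l: "\<And>i. i < N \<Longrightarrow> 0 \<le> l i" "(\<Sum>i<N. l i) = 1"
    and A: "\<And>i j. i < N \<Longrightarrow> A i j \<in> sym_mats (s i)"
    and y: "\<And>w. y w = (\<Sum>i<N. l i * normalized_trace (word_eval (s i) (A i) w))"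
  shows "tracial_moment_sequence y"
proof -
  \<comment> \<open>A positive common multiple of all sizes, so tuple \<open>i\<close> can be
    repeated \<open>S div s i\<close> times.\<close>
  define S where "S = (\<Prod>i<N. s i)"
  define m where "m i = S div s i" for i
  define A' where "A' i j = amplify (m i) (A i j)" for i j
  have S: "0 < S" using s by (auto simp: S_def intro: prod_pos)
  have ms: "m i * s i = S" if "i < N" for i
    using that by (simp add: m_def S_def dvd_prodI)
  have m: "0 < m i" if "i < N" for i using ms[OF that] S by (cases "m i") auto
  have carr: "A i j \<in> carrier_mat (s i) (s i)" if "i < N" for i j
    using A[OF that] by (simp add: sym_mats_def)
  have "A' i j \<in> sym_mats S" if "i < N" for i j
    using A[OF that, of j] amplify_carrier[OF carr[OF that], of "m i" j] ms[OF that]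
    by (simp add: sym_mats_def A'_def amplify_transpose[of _ "s i"])
  moreover have "normalized_trace (word_eval S (A' i) w) = normalized_trace (word_eval (s i) (A i) w)"
    if "i < N" for i w
    using word_eval_amplify[of "A i" "s i" "m i" w] carr[OF that] ms[OF that] m[OF that]
    by (simp add: A'_def[abs_def] normalized_trace_amplify[of _ "s i"] word_eval_carrier)
  ultimately show ?thesis
    unfolding tracial_moment_sequence_def using S l y
    by (intro exI[of _ N] exI[of _ S] exI[of _ l] exI[of _ A']) simp
qed

section \<open>From finite rank to the convex combination of traces\<close>

lemma finite_rank_basis:
  assumes "finite_rank_infmat M"
  obtains B where "finite B" "infmat_columns M \<subseteq> span B" "card B = infmat_rank M"
proof -
  obtain C where C: "finite C" "span (infmat_columns M) = span C"
    using assms by (auto simp: finite_rank_infmat_def)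
  obtain B where B: "B \<subseteq> infmat_columns M" "independent B" "infmat_columns M \<subseteq> span B"
      "card B = dim (infmat_columns M)"
    by (rule basis_exists)
  \<comment> \<open>Finite rank only provides some finite spanning set \<open>C\<close>; the
    independent set \<open>B\<close> is finite because it lies in the span of
    \<open>C\<close>.\<close>
  have "B \<subseteq> span C" using B(1) C(2) span_superset by blast
  then have "finite B" using independent_span_bound[OF C(1) B(2)] by blast
  then show thesis using that B by (simp add: infmat_rank_def)
qed

theorem theorem3p14:
  fixes y :: "'n::finite list \<Rightarrow> real" and t :: nat
  assumes "tracial_sequence y"
    and "psd_infmat (tracial_moment_matrix y)"
    and "finite_rank_infmat (tracial_moment_matrix y)"
    and "infmat_rank (tracial_moment_matrix y) = t"
  shows "tracial_moment_sequence y \<and>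
    (\<exists>(N::nat) (s :: nat \<Rightarrow> nat) (l :: nat \<Rightarrow> real) (A :: nat \<Rightarrow> 'n \<Rightarrow> real mat).
      (\<forall>i<N. 0 < s i \<and> s i \<le> t) \<and>
      (\<forall>i<N. 0 \<le> l i) \<and> (\<Sum>i<N. l i) = 1 \<and>
      (\<forall>i<N. \<forall>j. A i j \<in> sym_mats (s i)) \<and>
      (\<forall>w. y w = (\<Sum>i<N. l i * normalized_trace (word_eval (s i) (A i) w))))"
proof -
  obtain B where B: "finite B" "infmat_columns (tracial_moment_matrix y) \<subseteq> span B" "card B = t"
    using finite_rank_basis[OF assms(3)] assms(4) by auto
  \<comment> \<open>\<open>N\<close> is the dimension of the Euclidean space. The blocks are sets of
    its coordinates, so \<open>N \<le> t\<close> bounds the matrix sizes.\<close>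
  obtain N f V \<alpha> where N: "N \<le> t"
    and f: "\<forall>u v. tracial_moment_matrix y u v = (\<Sum>k<N. f k u * f k v)"
    and V: "finite V" and \<alpha>: "\<forall>k<N. \<forall>l<N. (\<Sum>v\<in>V. \<alpha> k v * f l v) = of_bool (k = l)"
    using psd_infmat_factorization[OF assms(2) B(1,2)] B(3) by blast
  interpret G: tracial_gram y N f V \<alpha>
  proof
    show "y (u @ v) = y (v @ u)" for u v
      using assms(1) by (auto simp: tracial_sequence_def cyc_equiv_def)
  qed (use f V \<alpha> in \<open>auto simp: tracial_moment_matrix_def\<close>)
  obtain Q d where Q: "\<And>k l. k < N \<Longrightarrow> l < N \<Longrightarrow> (\<Sum>a<N. Q a k * Q a l) = of_bool (k = l)"
    "\<And>a b. a < N \<Longrightarrow> b < N \<Longrightarrow> (\<Sum>k<N. Q a k * Q b k) = of_bool (a = b)"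
    "\<And>k l. k < N \<Longrightarrow> l < N \<Longrightarrow> (\<Sum>a<N. \<Sum>b<N. Q a k * G.trace_form a b * Q b l) = of_bool (k = l) * d k"
    using real_symmetric_diagonalization[of N G.trace_form] G.trace_form_sym by blast
  define g where "g = (\<lambda>k w. \<Sum>a<N. Q a k * f a w)"
  define \<beta> where "\<beta> = (\<lambda>k v. \<Sum>a<N. Q a k * \<alpha> a v)"
  note rotate = G.rotate[of Q d, OF Q]
  have diag: "diagonal_tracial_gram y N g V \<beta> d"
    using rotate by (simp add: diagonal_tracial_gram_def diagonal_tracial_gram_axioms_def g_def \<beta>_def)
  have "y [] = 1" using assms(1) by (simp add: tracial_sequence_def)
  from diagonal_tracial_gram.moments[OF diag this] obtain M :: nat and s l A where M: "\<forall>i<M. 0 < s i \<and> s i \<le> N" "\<forall>i<M. 0 \<le> l i" "(\<Sum>i<M. l i) = 1"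
    "\<forall>i<M. \<forall>j. A i j \<in> sym_mats (s i)"
    "\<forall>w. y w = (\<Sum>i<M. l i * normalized_trace (word_eval (s i) (A i) w))"
    by blast
  \<comment> \<open>The common size reached by amplification may exceed \<open>t\<close>, so the
    unamplified tuples serve for the second claim.\<close>
  have "tracial_moment_sequence y"
    by (rule tracial_moment_sequenceI[of M s l A]) (use M in auto)
  moreover have "\<forall>i<M. 0 < s i \<and> s i \<le> t" using M(1) N by fastforce
  ultimately show ?thesis using M(2-5)
    by (intro conjI exI[of _ M] exI[of _ s] exI[of _ l] exI[of _ A])
qed

end
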